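(* Let $d=2$ and let $p\in(0,1)$. Let $S=(S_n)_{n\ge 0}$ be the conservative random walk on $\mathbb{Z}^2$ started at the origin and corresponding to the constant sequence $p_n=p$, $n\ge 2$. Then $S$ is recurrent, that is, almost surely $S_n=(0,0)$ for infinitely many $n$.
   Context: Conservative random walk on $\mathbb{Z}^d$, $d\ge 2$, corresponding to a sequence $(p_n)_{n\ge 2}$ in $[0,1]$ (with the convention $p_1:=1$): let $e_1,\dots,e_d$ be the standard basis vectors of $\mathbb{R}^d$. Let $Y_1$ be uniformly distributed on the $2d$-element set $\{\pm e_1,\dots,\pm e_d\}$, and let $Y_1,Y_2,\dots$ be the (time-inhomogeneous) Markov chain on this set whose transition matrix between times $n$ and $n+1$ is $(1-p_n)I+\frac{p_n}{2d}A$, $n\ge 1$, where $I$ is the $2d\times 2d$ identity matrix and $A$ is the $2d\times 2d$ matrix of ones; i.e. with probability $1-p_n$ the next step repeats the previous one, and with probability $p_n$ (an "update") a fresh direction is chosen uniformly among all $2d$ directions. Set $S_0=\mathbf{0}$ and $S_n=Y_1+\dots+Y_n$. *)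

theory Defs
  imports "HOL-Probability.Probability" "HOL-Analysis.Analysis"
begin

definition directions :: "(int ^ 'd) set" where
  "directions = range (\<lambda>i. axis i 1) \<union> range (\<lambda>i. - axis i 1)"

text \<open>The entry at \<open>(x, y)\<close> of the matrix \<open>(1 - q) I + (q / (2 d)) A\<close> with \<open>A\<close> the matrix of ones.\<close>

definition step_matrix :: "real \<Rightarrow> int ^ 'd \<Rightarrow> int ^ 'd \<Rightarrow> real" where
  "step_matrix q x y = (1 - q) * of_bool (x = y) + q / (2 * real CARD('d)) * 1"

text \<open>The sequence of update probabilities is given for \<open>n \<ge> 2\<close> only; \<open>p\<^sub>1 = 1\<close> by convention.\<close>

definition update_prob :: "(nat \<Rightarrow> real) \<Rightarrow> nat \<Rightarrow> real" where
  "update_prob p n = (if n = 1 then 1 else p n)"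

text \<open>
  The steps are \<open>Y 1, Y 2, \<dots>\<close>; the value \<open>Y 0\<close> is unconstrained and never used.
  The last assumption states the Markov property and the transition probabilities together: given
  any history of positive probability, the next step has law \<open>step_matrix (update_prob p n) (x n)\<close>,
  which depends on the last entry of the history only.
\<close>

locale conservative_walk = prob_space M
  for M :: "'a measure" and p :: "nat \<Rightarrow> real" and Y :: "nat \<Rightarrow> 'a \<Rightarrow> int ^ 'd" +
  assumes update_range: "\<And>n. n \<ge> 2 \<Longrightarrow> p n \<in> {0..1}"
    and step_measurable: "\<And>n. n \<ge> 1 \<Longrightarrow> Y n \<in> measurable M (count_space directions)"
    and first_step_uniform:
      "distr M (count_space directions) (Y 1) = uniform_count_measure directions"
    and markov:
      "\<And>n x y. n \<ge> 1 \<Longrightarrow> (\<forall>k\<in>{1..n}. x k \<in> directions) \<Longrightarrow> y \<in> directions \<Longrightarrow>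
         \<P>(\<omega> in M. \<forall>k\<in>{1..n}. Y k \<omega> = x k) > 0 \<Longrightarrow>
         \<P>(\<omega> in M. Y (Suc n) \<omega> = y \<bar> \<forall>k\<in>{1..n}. Y k \<omega> = x k)
           = step_matrix (update_prob p n) (x n) y"

definition position :: "(nat \<Rightarrow> 'a \<Rightarrow> int ^ 'd) \<Rightarrow> nat \<Rightarrow> 'a \<Rightarrow> int ^ 'd" where
  "position Y n \<omega> = (\<Sum>k=1..n. Y k \<omega>)"

definition recurrent :: "'a measure \<Rightarrow> (nat \<Rightarrow> 'a \<Rightarrow> int ^ 'd) \<Rightarrow> bool" where
  "recurrent M S \<longleftrightarrow> (AE \<omega> in M. infinite {n. S n \<omega> = 0})"

end

theory Submission
  imports Defs
begin

text \<open>
  A quadratic martingale bounds \<open>E|S\<^sub>n|\<^sup>2\<close> by \<open>O(n)\<close>, so most of the mass of \<open>S\<^sub>n\<close> lies in a box with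
  \<open>O(n)\<close> points. An update occurs with probability \<open>p\<close> just after time \<open>n\<close> and makes the second half of
  a path of length \<open>2 n\<close> an independent stationary walk; as the law of \<open>S\<^sub>n\<close> is symmetric,
  \<open>P(S\<^bsub>2n\<^esub> = 0) \<ge> p (\<Sum>x. P(S\<^sub>n = x)\<^sup>2) \<ge> C / n\<close> by the Cauchy--Schwarz inequality. Hence the expected
  number of returns is infinite. By the pigeonhole principle this holds for the returns with some
  fixed last step, and the last exit decomposition then shows that from the corresponding state the
  walk returns almost surely; irreducibility extends this to all reachable states.
\<close>

section \<open>The one-step operator\<close>

lemma finite_directions [simp]: "finite (directions :: (int ^ 'd) set)"
  by (simp add: directions_def)

lemma bij_uminus_directions: "bij_betw uminus (directions :: (int ^ 'd) set) directions"
proof (rule bij_betwI[where g = uminus])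
  show "uminus \<in> directions \<rightarrow> (directions :: (int ^ 'd) set)"
    by (auto simp: directions_def)
  then show "uminus \<in> directions \<rightarrow> (directions :: (int ^ 'd) set)" .
qed auto

lemma card_directions: "card (directions :: (int ^ 'd) set) = 2 * CARD('d)"
proof -
  let ?f = "\<lambda>i. axis i 1 :: int ^ 'd" and ?g = "\<lambda>i. - axis i 1 :: int ^ 'd"
  have "inj ?f" "inj ?g"
    by (auto simp: inj_on_def axis_eq_axis)
  moreover have "range ?f \<inter> range ?g = {}"
  proof -
    have "?f i \<noteq> ?g j" for i j
    proof
      assume "?f i = ?g j"
      then have "?f i $ i = ?g j $ i" by simp
      then show False by (auto simp: axis_def split: if_splits)
    qed
    then show ?thesis by blast
  qed
  ultimately show ?thesis
    by (simp add: directions_def card_Un_disjoint card_image)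
qed

lemma zero_notin_directions: "(0 :: int ^ 'd) \<notin> directions"
  by (auto simp: directions_def axis_eq_0_iff dest: sym)

lemma sum_squares_direction:
  "z \<in> (directions :: (int ^ 'd) set) \<Longrightarrow> (\<Sum>i\<in>UNIV. (real_of_int (z $ i))\<^sup>2) = 1"
proof -
  assume "z \<in> directions"
  then obtain j where "z = axis j 1 \<or> z = - axis j 1"
    by (auto simp: directions_def)
  then have "(real_of_int (z $ i))\<^sup>2 = (if i = j then 1 else 0)" for i
    by (auto simp: axis_def)
  then show ?thesis by simp
qed

lemma sum_directions_component:
  "(\<Sum>z\<in>(directions :: (int ^ 'd) set). real_of_int (z $ i)) = 0"
  using sum.reindex_bij_betw[OF bij_uminus_directions, of "\<lambda>z. real_of_int (z $ i)"]
  by (simp add: sum_negf)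

text \<open>Transition operator of the chain (position, last step), killed on entering \<open>Z\<close>.\<close>

definition step_op ::
    "real \<Rightarrow> (int ^ 'd) set \<Rightarrow> (int ^ 'd \<Rightarrow> int ^ 'd \<Rightarrow> real) \<Rightarrow> int ^ 'd \<Rightarrow> int ^ 'd \<Rightarrow> real"
  where "step_op q Z f x y =
    (\<Sum>z\<in>directions. step_matrix q y z * (of_bool (x + z \<notin> Z) * f (x + z) z))"

text \<open>Only the parameter is fixed here: the analysis of the operator takes place without a
  probability space, which enters with \<open>constant_walk\<close>.\<close>

locale update_parameter =
  fixes q :: real
  assumes q0: "0 < q" and q1: "q < 1"
begin

text \<open>The bound is the update part of the transition: whatever the last step was, the law of
  the next one dominates \<open>q\<close> times the uniform law.\<close>

lemma step_matrix_ge: "step_matrix q y (z :: int ^ 'd) \<ge> q / (2 * real CARD('d))"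
  using q0 q1 by (simp add: step_matrix_def)

lemma step_matrix_pos: "step_matrix q y (z :: int ^ 'd) > 0"
proof -
  have "0 < q / (2 * real CARD('d))" using q0 by simp
  then show ?thesis using step_matrix_ge[of y z] by linarith
qed

lemma step_matrix_nonneg: "step_matrix q y (z :: int ^ 'd) \<ge> 0"
  using step_matrix_pos less_imp_le by blast

lemma step_matrix_commute: "step_matrix q y z = step_matrix q z y"
  by (auto simp: step_matrix_def)

lemma sum_step_matrix:
  assumes "y \<in> (directions :: (int ^ 'd) set)"
  shows "(\<Sum>z\<in>directions. step_matrix q y z * f z) =
    (1 - q) * f y + q / (2 * real CARD('d)) * (\<Sum>z\<in>directions. f z)"
proof -
  have "(\<Sum>z\<in>directions. step_matrix q y z * f z) =
    (\<Sum>z\<in>directions. (if y = z then (1 - q) * f z else 0) + q / (2 * real CARD('d)) * f z)"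
    by (intro sum.cong) (auto simp: step_matrix_def algebra_simps)
  also have "\<dots> = (1 - q) * f y + q / (2 * real CARD('d)) * (\<Sum>z\<in>directions. f z)"
    using assms by (simp add: sum.distrib sum_distrib_left)
  finally show ?thesis .
qed

lemma sum_step_matrix_1:
  assumes "y \<in> (directions :: (int ^ 'd) set)"
  shows "(\<Sum>z\<in>directions. step_matrix q y z) = 1"
  using sum_step_matrix[OF assms, of "\<lambda>_. 1"] by (simp add: card_directions)

lemma step_matrix_le_1:
  assumes "y \<in> (directions :: (int ^ 'd) set)" "z \<in> directions"
  shows "step_matrix q y z \<le> 1"
proof -
  have "step_matrix q y z \<le> (\<Sum>z\<in>directions. step_matrix q y z)"
    using assms step_matrix_nonneg by (intro member_le_sum) auto
  then show ?thesis using sum_step_matrix_1[OF assms(1)] by simp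
qed

section \<open>Monotonicity and linearity of the operator\<close>

lemma step_op_mono:
  assumes "\<And>x y. y \<in> directions \<Longrightarrow> f x y \<le> g x y"
  shows "step_op q Z f x y \<le> step_op q Z g x y"
  unfolding step_op_def using assms step_matrix_nonneg
  by (intro sum_mono mult_left_mono) auto

text \<open>The functions are compared only where the last step is a direction. The bounds on
  \<open>energy\<close> rely on this, since they need a last step of length one.\<close>

lemma funpow_step_op_mono:
  assumes "\<And>x y. y \<in> directions \<Longrightarrow> f x y \<le> g x y" "y \<in> directions"
  shows "(step_op q Z ^^ n) f x y \<le> (step_op q Z ^^ n) g x y"
  using assms(2)
proof (induction n arbitrary: x y)
  case 0
  then show ?case using assms(1) by simp
next
  case (Suc n)
  then show ?case by (auto intro: step_op_mono)
qed

lemma step_op_cong: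
  assumes "\<And>x y. y \<in> directions \<Longrightarrow> f x y = g x y"
  shows "step_op q Z f x y = step_op q Z g x y"
  using assms by (simp add: step_op_def)

lemma step_op_sum:
  "step_op q Z (\<lambda>x y. \<Sum>i\<in>I. a i * f i x y) x y = (\<Sum>i\<in>I. a i * step_op q Z (f i) x y)"
  unfolding step_op_def sum_distrib_left
  by (subst sum.swap) (simp add: mult_ac)

lemma funpow_step_op_sum:
  "(step_op q Z ^^ n) (\<lambda>x y. \<Sum>i\<in>I. a i * f i x y) = (\<lambda>x y. \<Sum>i\<in>I. a i * (step_op q Z ^^ n) (f i) x y)"
  by (induction n) (simp_all add: step_op_sum)

text \<open>Without killing, \<open>Z = {}\<close>, the transition weights sum to one, so constants
  are preserved.\<close>

lemma step_op_affine:
  assumes "y \<in> directions"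
  shows "step_op q {} (\<lambda>x y. a * f x y + b) x y = a * step_op q {} f x y + b"
proof -
  have "step_op q {} (\<lambda>x y. a * f x y + b) x y =
      (\<Sum>z\<in>directions. a * (step_matrix q y z * f (x + z) z) + step_matrix q y z * b)"
    unfolding step_op_def by (simp add: algebra_simps)
  also have "\<dots> = a * step_op q {} f x y + (\<Sum>z\<in>directions. step_matrix q y z) * b"
    by (simp add: sum.distrib step_op_def sum_distrib_left sum_distrib_right)
  finally show ?thesis using sum_step_matrix_1[OF assms] by simp
qed

lemma funpow_step_op_affine:
  assumes "y \<in> directions"
  shows "(step_op q {} ^^ n) (\<lambda>x y. a * f x y + b) x y = a * (step_op q {} ^^ n) f x y + b"
  using assms
proof (induction n arbitrary: x y)
  case (Suc n)
  have "(step_op q {} ^^ Suc n) (\<lambda>x y. a * f x y + b) x y =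
      step_op q {} (\<lambda>x y. a * (step_op q {} ^^ n) f x y + b) x y"
    unfolding funpow.simps comp_def
    by (rule step_op_cong) (rule Suc.IH)
  then show ?case using step_op_affine[OF Suc.prems] by simp
qed simp

lemma funpow_step_op_nonneg:
  assumes "\<And>x y. y \<in> directions \<Longrightarrow> 0 \<le> f x y" "y \<in> directions"
  shows "0 \<le> (step_op q Z ^^ n) f x y"
  using assms(2)
proof (induction n arbitrary: x y)
  case 0
  then show ?case using assms(1) by simp
next
  case (Suc n)
  then show ?case
    using step_matrix_nonneg by (auto simp: step_op_def intro!: sum_nonneg mult_nonneg_nonneg)
qed

section \<open>The displacement is diffusive\<close>

text \<open>\<open>S\<^sub>n + (1 / q - 1) Y\<^sub>n\<close> is a martingale, and this is its squared norm.\<close>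

definition energy :: "int ^ 'd \<Rightarrow> int ^ 'd \<Rightarrow> real"
  where "energy x y = (\<Sum>i\<in>UNIV. (real_of_int (x $ i) + (1 / q - 1) * real_of_int (y $ i))\<^sup>2)"

lemma energy_expand:
  assumes "y \<in> directions"
  shows "(\<Sum>i\<in>UNIV. (real_of_int (x $ i) + c * real_of_int (y $ i))\<^sup>2) =
    (\<Sum>i\<in>UNIV. (real_of_int (x $ i))\<^sup>2) + 2 * c * (\<Sum>i\<in>UNIV. real_of_int (x $ i) * real_of_int (y $ i)) + c\<^sup>2"
proof -
  have "(\<Sum>i\<in>UNIV. (real_of_int (x $ i) + c * real_of_int (y $ i))\<^sup>2) =
    (\<Sum>i\<in>UNIV. (real_of_int (x $ i))\<^sup>2 + 2 * c * (real_of_int (x $ i) * real_of_int (y $ i))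
      + c\<^sup>2 * (real_of_int (y $ i))\<^sup>2)"
    by (intro sum.cong) (auto simp: power2_eq_square algebra_simps)
  then show ?thesis
    using sum_squares_direction[OF assms] by (simp add: sum.distrib flip: sum_distrib_left)
qed

text \<open>After a step \<open>z\<close> from \<open>x\<close> the martingale is at
  \<open>x + z / q\<close>. A uniform update averages the cross term to zero, so a fraction
  \<open>1 - q\<close> of \<open>2 / q * I y\<close> survives, which is exactly the cross term of
  \<open>energy x y\<close>. The increment is the difference of the constants,
  \<open>1 / q\<^sup>2 - (1 / q - 1)\<^sup>2 = 2 / q - 1\<close>.\<close>

lemma step_op_energy:
  fixes x y :: "int ^ 'd"
  assumes y: "y \<in> directions"
  shows "step_op q {} energy x y = energy x y + (2 / q - 1)"
proof -
  define X where "X = (\<Sum>i\<in>UNIV. (real_of_int (x $ i))\<^sup>2)"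
  define I where "I z = (\<Sum>i\<in>UNIV. real_of_int (x $ i) * real_of_int (z $ i))" for z :: "int ^ 'd"
  have e: "energy (x + z) z = X + 2 / q * I z + 1 / q\<^sup>2" if "z \<in> directions" for z
  proof -
    have "energy (x + z) z = (\<Sum>i\<in>UNIV. (real_of_int (x $ i) + 1 / q * real_of_int (z $ i))\<^sup>2)"
      unfolding energy_def by (simp add: algebra_simps)
    then show ?thesis using energy_expand[OF that, of x "1 / q"]
      by (simp add: X_def I_def power_divide)
  qed
  have I0: "(\<Sum>z\<in>directions. I z) = 0"
    unfolding I_def by (subst sum.swap) (simp add: sum_directions_component flip: sum_distrib_left)
  have "step_op q {} energy x y = (\<Sum>z\<in>directions. step_matrix q y z * (X + 2 / q * I z + 1 / q\<^sup>2))"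
    unfolding step_op_def using e by simp
  also have "\<dots> = (1 - q) * (X + 2 / q * I y + 1 / q\<^sup>2)
      + q / (2 * real CARD('d)) * (\<Sum>z\<in>(directions :: (int ^ 'd) set). X + 2 / q * I z + 1 / q\<^sup>2)"
    by (rule sum_step_matrix[OF y])
  also have "(\<Sum>z\<in>(directions :: (int ^ 'd) set). X + 2 / q * I z + 1 / q\<^sup>2)
      = 2 * real CARD('d) * (X + 1 / q\<^sup>2)"
  proof -
    have "(\<Sum>z\<in>directions. 2 / q * I z) = 0"
      using I0 sum_distrib_left[of "2 / q" I directions] by simp
    then show ?thesis by (simp add: sum.distrib card_directions algebra_simps)
  qed
  also have "q / (2 * real CARD('d)) * \<dots> = q * (X + 1 / q\<^sup>2)"
    by simp
  also have "(1 - q) * (X + 2 / q * I y + 1 / q\<^sup>2) + q * (X + 1 / q\<^sup>2)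
      = X + 1 / q\<^sup>2 + (1 - q) * (2 / q) * I y"
    by (simp only: algebra_simps)
  also have "(1 - q) * (2 / q) = 2 * (1 / q - 1)"
    using q0 by (simp add: field_simps)
  finally have "step_op q {} energy x y = X + 2 * (1 / q - 1) * I y + 1 / q\<^sup>2"
    by simp
  moreover have "energy x y = X + 2 * (1 / q - 1) * I y + (1 / q - 1)\<^sup>2"
    unfolding energy_def using energy_expand[OF y] by (simp add: X_def I_def)
  ultimately show ?thesis
    using q0 by (simp add: power2_eq_square algebra_simps)
qed

lemma funpow_step_op_energy:
  assumes "y \<in> directions"
  shows "(step_op q {} ^^ n) energy x y = energy x y + real n * (2 / q - 1)"
  using assms
proof (induction n arbitrary: x y)
  case (Suc n)
  \<comment> \<open>The factor 1 brings the function into the form treated by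
    \<open>step_op_affine\<close>.\<close>
  have "(step_op q {} ^^ Suc n) energy x y = step_op q {} (\<lambda>x y. 1 * energy x y + real n * (2 / q - 1)) x y"
    unfolding funpow.simps comp_def by (rule step_op_cong) (simp add: Suc.IH)
  also have "\<dots> = energy x y + real (Suc n) * (2 / q - 1)"
    unfolding step_op_affine[OF Suc.prems] step_op_energy[OF Suc.prems] by (simp add: algebra_simps add_divide_distrib)
  finally show ?case .
qed simp

section \<open>Concentration in a box with sides of order sqrt n\<close>

definition box :: "nat \<Rightarrow> (int ^ 'd) set"
  where "box K = {x. \<forall>i. \<bar>x $ i\<bar> \<le> int K}"

lemma card_box: "finite (box K :: (int ^ 'd) set)" "card (box K :: (int ^ 'd) set) = (2 * K + 1) ^ CARD('d)"
proof -
  let ?P = "PiE (UNIV :: 'd set) (\<lambda>_. {- int K..int K})"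
  have bij: "bij_betw vec_nth (box K :: (int ^ 'd) set) ?P"
    by (rule bij_betwI[where g = vec_lambda]) (auto simp: box_def PiE_iff abs_le_iff minus_le_iff)
  have "finite ?P" by (intro finite_PiE) auto
  then show "finite (box K :: (int ^ 'd) set)" using bij_betw_finite[OF bij] by simp
  have "card {- int K..int K} = 2 * K + 1" by simp
  then show "card (box K :: (int ^ 'd) set) = (2 * K + 1) ^ CARD('d)"
    using bij_betw_same_card[OF bij] by (simp add: card_PiE)
qed

text \<open>Some coordinate of \<open>x\<close> exceeds \<open>K\<close> in absolute value, and the
  correction term changes it by at most \<open>1 / q - 1\<close>, so a single summand of
  \<open>energy\<close> is already large enough.\<close>

lemma not_in_box_le_energy:
  assumes y: "y \<in> directions" and x: "x \<notin> box K" and K: "1 / q - 1 < real K"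
  shows "(real K - (1 / q - 1))\<^sup>2 \<le> energy x y"
proof -
  let ?c = "1 / q - 1"
  have c: "?c \<ge> 0" using q0 q1 by simp
  obtain i where i: "\<bar>x $ i\<bar> > int K" using x by (auto simp: box_def not_le)
  have "(real_of_int (y $ i))\<^sup>2 \<le> (\<Sum>i\<in>UNIV. (real_of_int (y $ i))\<^sup>2)"
    by (rule member_le_sum) auto
  then have "\<bar>real_of_int (y $ i)\<bar> \<le> 1"
    using sum_squares_direction[OF y] abs_square_le_1 by auto
  then have "\<bar>?c * real_of_int (y $ i)\<bar> \<le> ?c"
    using c by (simp add: abs_mult mult_left_le)
  moreover have "real K \<le> \<bar>real_of_int (x $ i)\<bar>" using i by linarith
  ultimately have "real K - ?c \<le> \<bar>real_of_int (x $ i) + ?c * real_of_int (y $ i)\<bar>" by linarith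
  then have "(real K - ?c)\<^sup>2 \<le> (real_of_int (x $ i) + ?c * real_of_int (y $ i))\<^sup>2"
    using K power_mono[of "real K - ?c" "\<bar>real_of_int (x $ i) + ?c * real_of_int (y $ i)\<bar>" 2] by simp
  also have "\<dots> \<le> energy x y"
    unfolding energy_def by (rule member_le_sum) auto
  finally show ?thesis .
qed

text \<open>Chebyshev's inequality: \<open>1 - energy / R\<close> lies below the indicator of the
  box, and the mean energy at time \<open>n\<close> is at most \<open>n / q\<^sup>2\<close>, hence
  at most \<open>R / 4\<close>.\<close>

lemma box_probability:
  assumes y: "y \<in> directions" and n: "n \<ge> 1" and K: "real K \<ge> 3 * sqrt (real n) / q"
  shows "(step_op q {} ^^ n) (\<lambda>x _. of_bool (x \<in> box K)) 0 y \<ge> 3 / 4"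
proof -
  define R where "R = (real K - (1 / q - 1))\<^sup>2"
  have s: "sqrt (real n) \<ge> 1" using n by simp
  \<comment> \<open>One of the three multiples of \<open>sqrt n / q\<close> in \<open>K\<close>
    absorbs the correction \<open>1 / q - 1\<close>.\<close>
  have "2 * sqrt (real n) / q \<le> real K - (1 / q - 1)"
  proof -
    have "1 / q \<le> sqrt (real n) / q" using s q0 by (simp add: divide_right_mono)
    then show ?thesis using K by linarith
  qed
  then have "(2 * sqrt (real n) / q)\<^sup>2 \<le> R"
    unfolding R_def using q0 s by (intro power_mono) auto
  then have R: "4 * real n / q\<^sup>2 \<le> R" by (simp add: power_divide power_mult_distrib)
  have "0 < 4 * real n / q\<^sup>2" using n q0 by simp
  then have R0: "R > 0" using R by linarith
  have Kc: "1 / q - 1 < real K"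
  proof -
    have "0 < 2 * sqrt (real n) / q" using s q0 by simp
    then show ?thesis using \<open>2 * sqrt (real n) / q \<le> real K - (1 / q - 1)\<close> by linarith
  qed
  have "energy 0 y = (1 / q - 1)\<^sup>2"
    using energy_expand[OF y, of 0] by (simp add: energy_def)
  then have "(step_op q {} ^^ n) energy 0 y = (1 / q - 1)\<^sup>2 + real n * (2 / q - 1)"
    by (simp add: funpow_step_op_energy[OF y])
  \<comment> \<open>Multiplying the initial energy by \<open>n \<ge> 1\<close> makes the sum
    collapse to \<open>n / q\<^sup>2\<close>.\<close>
  also have "\<dots> \<le> real n * (1 / q - 1)\<^sup>2 + real n * (2 / q - 1)"
    using n mult_right_mono[of 1 "real n" "(1 / q - 1)\<^sup>2"] by simp
  also have "\<dots> = real n / q\<^sup>2"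
    using q0 by (simp add: power2_eq_square field_simps)
  finally have "(step_op q {} ^^ n) energy 0 y \<le> R / 4" using R by simp
  moreover have "(step_op q {} ^^ n) (\<lambda>x y. (- 1 / R) * energy x y + 1) 0 y
      \<le> (step_op q {} ^^ n) (\<lambda>x _. of_bool (x \<in> box K)) 0 y"
  proof (rule funpow_step_op_mono[OF _ y])
    fix x z :: "int ^ 'a" assume z: "z \<in> directions"
    have "energy x z \<ge> 0" by (simp add: energy_def sum_nonneg)
    moreover have "R \<le> energy x z" if "x \<notin> box K"
      using not_in_box_le_energy[OF z that Kc] by (simp add: R_def)
    ultimately show "(- 1 / R) * energy x z + 1 \<le> of_bool (x \<in> box K)"
      using R0 by (auto simp: field_simps)
  qed
  moreover have "(- 1 / R) * (step_op q {} ^^ n) energy 0 y \<ge> (- 1 / R) * (R / 4)"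
    using calculation(1) R0 by (intro mult_left_mono_neg) auto
  moreover have "(- 1 / R) * (R / 4) + 1 = 3 / 4" using R0 by simp
  ultimately show ?thesis
    unfolding funpow_step_op_affine[OF y] by linarith
qed

section \<open>Return probabilities of the stationary walk\<close>

text \<open>\<open>occ n a\<close> is the probability that the walk with stationary (uniform) steps is at \<open>a\<close> at
  time \<open>n\<close>: its starting direction \<open>y\<close> is a fictitious step at time \<open>0\<close>.\<close>

definition hit :: "nat \<Rightarrow> int ^ 'd \<Rightarrow> int ^ 'd \<Rightarrow> int ^ 'd \<Rightarrow> real"
  where "hit n a = (step_op q {} ^^ n) (\<lambda>x _. of_bool (x = a))"

definition occ :: "nat \<Rightarrow> int ^ 'd \<Rightarrow> real"
  where "occ n a = (\<Sum>y\<in>directions. hit n a 0 y) / (2 * real CARD('d))"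

lemma hit_Suc: "hit (Suc n) a x y = (\<Sum>z\<in>directions. step_matrix q y z * hit n a (x + z) z)"
  by (simp add: hit_def step_op_def)

lemma hit_0: "hit 0 a x y = of_bool (x = a)"
  by (simp add: hit_def)

lemma hit_shift: "hit n (a + b) (x + b) y = hit n a x y"
proof (induction n arbitrary: x y)
  case (Suc n)
  have "x + b + z = x + z + b" for z by simp
  then show ?case by (simp only: hit_Suc Suc.IH)
qed (simp add: hit_0)

text \<open>\<open>directions\<close> is symmetric, and \<open>step_matrix\<close> depends only on
  whether its two directions agree.\<close>

lemma hit_uminus: "hit n (- a) (- x) (- y) = hit n a x y"
proof (induction n arbitrary: x y)
  case (Suc n)
  have "hit (Suc n) (- a) (- x) (- y) =
      (\<Sum>z\<in>directions. step_matrix q (- y) (- z) * hit n (- a) (- x + - z) (- z))"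
    unfolding hit_Suc by (rule sum.reindex_bij_betw[OF bij_uminus_directions, symmetric])
  also have "\<dots> = hit (Suc n) a x y"
    unfolding hit_Suc
  proof (rule sum.cong)
    fix z
    have "step_matrix q (- y) (- z) = step_matrix q y z" by (simp add: step_matrix_def)
    moreover have "- x + - z = - (x + z)" by simp
    ultimately show "step_matrix q (- y) (- z) * hit n (- a) (- x + - z) (- z) =
        step_matrix q y z * hit n a (x + z) z"
      using Suc.IH[of "x + z" z] by (simp only:)
  qed simp
  finally show ?case .
qed (simp add: hit_0)

lemma hit_nonneg: "y \<in> directions \<Longrightarrow> 0 \<le> hit n a x y"
  unfolding hit_def by (rule funpow_step_op_nonneg) auto

lemma occ_nonneg: "0 \<le> occ n a"
  unfolding occ_def using hit_nonneg by (auto intro!: divide_nonneg_nonneg sum_nonneg)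

lemma occ_Suc: "occ (Suc n) (a :: int ^ 'd) = (\<Sum>z\<in>directions. hit n a z z) / (2 * real CARD('d))"
proof -
  have "(\<Sum>y\<in>directions. hit (Suc n) a 0 y) = (\<Sum>z\<in>directions. \<Sum>y\<in>directions. step_matrix q y z * hit n a z z)"
    unfolding hit_Suc by (subst sum.swap) simp
  also have "\<dots> = (\<Sum>z\<in>directions. (\<Sum>y\<in>directions. step_matrix q z y) * hit n a z z)"
    by (simp add: sum_distrib_right step_matrix_commute)
  also have "\<dots> = (\<Sum>z\<in>directions. hit n a z z)"
    by (intro sum.cong) (simp_all add: sum_step_matrix_1)
  finally show ?thesis by (simp add: occ_def)
qed

text \<open>With probability \<open>q\<close> the first step is an update, which makes the walk from \<open>x\<close> stationary;
  the reflection of a stationary walk from \<open>x\<close> to \<open>0\<close> goes from \<open>0\<close> to \<open>x\<close>.\<close>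

lemma hit_ge_occ:
  fixes x y :: "int ^ 'd"
  shows "hit (Suc n) 0 x y \<ge> q * occ (Suc n) x"
proof -
  have "(\<Sum>z\<in>directions. hit n x z z) = (\<Sum>z\<in>directions. hit n x (- z) (- z))"
    by (rule sum.reindex_bij_betw[OF bij_uminus_directions, symmetric])
  also have "\<dots> = (\<Sum>z\<in>directions. hit n 0 (x + z) z)"
    using hit_uminus[of n "- x"] hit_shift[of n "- x" x] by (simp add: add.commute)
  finally have "q * occ (Suc n) x = (\<Sum>z\<in>directions. q / (2 * real CARD('d)) * hit n 0 (x + z) z)"
    by (simp add: occ_Suc sum_distrib_left sum_divide_distrib)
  also have "\<dots> \<le> hit (Suc n) 0 x y"
    unfolding hit_Suc by (intro sum_mono mult_right_mono step_matrix_ge hit_nonneg)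
  finally show ?thesis .
qed

text \<open>Split the path at time \<open>n\<close> according to its position. From any state at
  \<open>x\<close> the second half leads to 0 with probability at least \<open>q * occ n x\<close>
  by \<open>hit_ge_occ\<close>; restricting to positions in \<open>F\<close> discards only
  nonnegative terms.\<close>

lemma occ_double:
  assumes F: "finite (F :: (int ^ 'd) set)" and n: "n \<ge> 1"
  shows "occ (2 * n) (0 :: int ^ 'd) \<ge> q * (\<Sum>a\<in>F. (occ n a)\<^sup>2)"
proof -
  \<comment> \<open>\<open>hit_ge_occ\<close> needs at least one step, in which the update can
    happen.\<close>
  obtain m where m: "n = Suc m" using n by (cases n) auto
  have *: "(\<Sum>a\<in>F. q * occ n a * hit n a 0 y) \<le> hit (2 * n) 0 0 y" if y: "y \<in> directions" for y :: "int ^ 'd"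
  proof -
    have "(\<Sum>a\<in>F. q * occ n a * hit n a 0 y)
        = (step_op q {} ^^ n) (\<lambda>x y. \<Sum>a\<in>F. q * occ n a * of_bool (x = a)) 0 y"
      unfolding funpow_step_op_sum by (simp add: hit_def)
    also have "\<dots> \<le> (step_op q {} ^^ n) (hit n 0) 0 y"
    proof (rule funpow_step_op_mono[OF _ y])
      fix x z :: "int ^ 'd" assume z: "z \<in> directions"
      have "(\<Sum>a\<in>F. q * occ n a * of_bool (x = a)) = (\<Sum>a\<in>F. if a = x then q * occ n a else 0)"
        by (intro sum.cong) auto
      also have "\<dots> \<le> q * occ n x"
        using F q0 by (simp add: occ_nonneg)
      also have "\<dots> \<le> hit n 0 x z"
        unfolding m by (rule hit_ge_occ)
      finally show "(\<Sum>a\<in>F. q * occ n a * of_bool (x = a)) \<le> hit n 0 x z" .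
    qed
    also have "\<dots> = hit (2 * n) 0 0 y"
      unfolding hit_def by (simp add: mult_2 funpow_add)
    finally show ?thesis .
  qed
  have "q * (\<Sum>a\<in>F. (occ n a)\<^sup>2) =
      (\<Sum>a\<in>F. q * occ n a * (\<Sum>y\<in>directions. hit n a 0 y)) / (2 * real CARD('d))"
    unfolding sum_distrib_left[of q] sum_divide_distrib[of _ F]
    by (intro sum.cong refl) (simp add: power2_eq_square occ_def)
  also have "(\<Sum>a\<in>F. q * occ n a * (\<Sum>y\<in>directions. hit n a 0 y))
      = (\<Sum>y\<in>directions. \<Sum>a\<in>F. q * occ n a * hit n a 0 y)"
    unfolding sum_distrib_left by (rule sum.swap)
  also have "\<dots> / (2 * real CARD('d)) \<le> occ (2 * n) (0 :: int ^ 'd)"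
    unfolding occ_def[of "2 * n"] using * by (intro divide_right_mono sum_mono) auto
  finally show ?thesis .
qed

text \<open>Mass at least 3/4 sits on at most \<open>81 * n / q\<^sup>2\<close> points, the volume
  being linear in \<open>n\<close> because the dimension is two. Cauchy-Schwarz yields
  \<open>(9 / 16) / 81 = 1 / 144\<close>, and \<open>occ_double\<close> contributes the third factor
  \<open>q\<close>.\<close>

lemma occ_lower_bound:
  assumes n: "n \<ge> 1"
  shows "occ (2 * n) (0 :: int ^ 2) \<ge> q ^ 3 / 144 / real n"
proof -
  define K where "K = nat \<lceil>3 * sqrt (real n) / q\<rceil>"
  define B where "B = (box K :: (int ^ 2) set)"
  define s where "s = sqrt (real n) / q"
  have "sqrt (real n) \<ge> 1" using n by simp
  then have "q \<le> sqrt (real n)" using q1 by linarith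
  then have s1: "s \<ge> 1" unfolding s_def using q0 by (simp add: field_simps)
  have K3: "real K \<ge> 3 * sqrt (real n) / q" unfolding K_def by linarith
  have "real K \<le> 3 * s + 1"
  proof -
    have "0 \<le> 3 * sqrt (real n) / q" using q0 by simp
    then show ?thesis
      using of_int_ceiling_le_add_one[of "3 * sqrt (real n) / q"] by (simp add: K_def s_def)
  qed
  \<comment> \<open>\<open>2 * K + 1\<close> is at most \<open>6 * s + 3\<close>, and
    \<open>s \<ge> 1\<close>.\<close>
  then have "real (2 * K + 1) \<le> 9 * s" using s1 by simp
  then have "(real (2 * K + 1))\<^sup>2 \<le> (9 * s)\<^sup>2" by (intro power_mono) auto
  then have card: "real (card B) \<le> 81 * real n / q\<^sup>2"
    unfolding B_def card_box s_def by (simp add: power_divide power_mult_distrib)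
  have fin: "finite B" by (simp add: B_def card_box)
  have "(\<Sum>a\<in>B. hit n a 0 y) \<ge> 3 / 4" if y: "y \<in> directions" for y
  proof -
    have "(\<lambda>x (_ :: int ^ 2). of_bool (x \<in> box K)) = (\<lambda>x _. \<Sum>a\<in>B. 1 * of_bool (x = a) :: real)"
      using fin by (auto simp: fun_eq_iff B_def of_bool_def)
    then have "(\<Sum>a\<in>B. hit n a 0 y) = (step_op q {} ^^ n) (\<lambda>x _. of_bool (x \<in> box K)) 0 y"
      using funpow_step_op_sum[of n "{}" "\<lambda>_. 1" "\<lambda>a x _. of_bool (x = a)" B]
      by (simp add: hit_def)
    then show ?thesis using box_probability[OF y n K3] by simp
  qed
  then have "(\<Sum>y\<in>(directions :: (int ^ 2) set). 3 / 4) \<le> (\<Sum>y\<in>directions. \<Sum>a\<in>B. hit n a 0 y)"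
    by (intro sum_mono) auto
  also have "\<dots> = (\<Sum>a\<in>B. \<Sum>y\<in>directions. hit n a 0 y)" by (rule sum.swap)
  finally have "3 / 4 \<le> (\<Sum>a\<in>B. occ n a)"
    by (simp add: occ_def card_directions flip: sum_divide_distrib)
  then have "(3 / 4)\<^sup>2 \<le> (\<Sum>a\<in>B. occ n a)\<^sup>2" by (intro power_mono) auto
  also have "\<dots> \<le> (\<Sum>a\<in>B. (occ n a)\<^sup>2) * real (card B)"
    by (rule sum_squared_le_sum_of_squares)
  also have "\<dots> \<le> (\<Sum>a\<in>B. (occ n a)\<^sup>2) * (81 * real n / q\<^sup>2)"
    using card by (intro mult_left_mono sum_nonneg) auto
  finally have "q\<^sup>2 / 144 / real n \<le> (\<Sum>a\<in>B. (occ n a)\<^sup>2)"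
    using n q0 by (simp add: field_simps)
  then have "q * (q\<^sup>2 / 144 / real n) \<le> q * (\<Sum>a\<in>B. (occ n a)\<^sup>2)"
    using q0 by (intro mult_left_mono) auto
  also have "\<dots> \<le> occ (2 * n) (0 :: int ^ 2)" by (rule occ_double[OF fin n])
  finally show ?thesis by (simp add: power2_eq_square power3_eq_cube)
qed

end

section \<open>Path events\<close>

definition endpoint :: "nat \<Rightarrow> (nat \<Rightarrow> int ^ 'd) \<Rightarrow> int ^ 'd"
  where "endpoint n a = (\<Sum>k=1..n. a k)"

lemma endpoint_Suc [simp]: "endpoint (Suc n) a = endpoint n a + a (Suc n)"
  by (simp add: endpoint_def)

lemma endpoint_cong:
  "(\<And>k. 1 \<le> k \<Longrightarrow> k \<le> n \<Longrightarrow> a k = b k) \<Longrightarrow> endpoint n a = endpoint n b"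
  by (simp add: endpoint_def)

text \<open>Path version of measurability with respect to the first \<open>n\<close> steps. Index 0
  is left out because \<open>Y 0\<close> is unconstrained; one implication suffices since
  \<open>a\<close> and \<open>b\<close> can be exchanged.\<close>

definition determined :: "nat \<Rightarrow> ((nat \<Rightarrow> int ^ 'd) \<Rightarrow> bool) \<Rightarrow> bool"
  where "determined n \<phi> \<longleftrightarrow> (\<forall>a b. (\<forall>k\<in>{1..n}. a k = b k) \<longrightarrow> \<phi> a \<longrightarrow> \<phi> b)"

lemma determinedD: "determined n \<phi> \<Longrightarrow> \<phi> a \<Longrightarrow> (\<And>k. 1 \<le> k \<Longrightarrow> k \<le> n \<Longrightarrow> a k = b k) \<Longrightarrow> \<phi> b"
  unfolding determined_def by (metis atLeastAtMost_iff)

lemma determined_mono: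
  assumes "determined m \<phi>" "m \<le> n"
  shows "determined n \<phi>"
  using assms unfolding determined_def by (meson atLeastAtMost_iff le_trans)

lemma determined_conj: "determined n \<phi> \<Longrightarrow> determined n \<psi> \<Longrightarrow> determined n (\<lambda>a. \<phi> a \<and> \<psi> a)"
  unfolding determined_def by blast

lemma determined_step: "1 \<le> k \<Longrightarrow> k \<le> n \<Longrightarrow> determined n (\<lambda>a. P (a k))"
  by (auto simp: determined_def)

lemma determined_endpoint:
  fixes P :: "int ^ 'd \<Rightarrow> bool"
  assumes "m \<le> n"
  shows "determined n (\<lambda>a. P (endpoint m a))"
  unfolding determined_def
proof (intro allI impI)
  fix a b :: "nat \<Rightarrow> int ^ 'd"
  assume "\<forall>k\<in>{1..n}. a k = b k" "P (endpoint m a)"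
  moreover from this have "endpoint m a = endpoint m b"
    using assms by (intro endpoint_cong) auto
  ultimately show "P (endpoint m b)" by simp
qed

lemma determined_Ball: "(\<And>i. i \<in> I \<Longrightarrow> determined n (\<phi> i)) \<Longrightarrow> determined n (\<lambda>a. \<forall>i\<in>I. \<phi> i a)"
  unfolding determined_def by blast

section \<open>Cylinder events and the Markov property\<close>

locale constant_walk = conservative_walk M "\<lambda>_. q" Y + update_parameter q
  for M :: "'a measure" and q :: real and Y :: "nat \<Rightarrow> 'a \<Rightarrow> int ^ 'd"
begin

abbreviation path_event :: "((nat \<Rightarrow> int ^ 'd) \<Rightarrow> bool) \<Rightarrow> 'a set"
  where "path_event \<phi> \<equiv> {\<omega> \<in> space M. \<phi> (\<lambda>k. Y k \<omega>)}"

lemma step_in_directions: "1 \<le> k \<Longrightarrow> \<omega> \<in> space M \<Longrightarrow> Y k \<omega> \<in> directions"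
  using measurable_space[OF step_measurable] by simp

lemma step_event:
  assumes "1 \<le> k"
  shows "{\<omega> \<in> space M. Y k \<omega> = z} \<in> events"
proof -
  have "{\<omega> \<in> space M. Y k \<omega> = z} = Y k -` ({z} \<inter> directions) \<inter> space M"
    using step_in_directions[OF assms] by auto
  then show ?thesis
    using measurable_sets[OF step_measurable[OF assms], of "{z} \<inter> directions"] by simp
qed

lemma cylinder_event: "path_event (\<lambda>a. \<forall>k\<in>{1..n}. a k = x k) \<in> events"
  by (rule sets.sets_Collect_finite_All) (auto intro: step_event)

text \<open>Histories are extensional functions, so there are finitely many and distinct ones differ
  at some time in \<open>{1..n}\<close>.\<close>

definition cylinders :: "nat \<Rightarrow> ((nat \<Rightarrow> int ^ 'd) \<Rightarrow> bool) \<Rightarrow> (nat \<Rightarrow> int ^ 'd) set"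
  where "cylinders n \<phi> = {x \<in> PiE {1..n} (\<lambda>_. directions). \<phi> x}"

lemma finite_cylinders: "finite (cylinders n \<phi>)"
proof -
  have "finite (PiE {1..n} (\<lambda>_. directions :: (int ^ 'd) set))" by (intro finite_PiE) auto
  then show ?thesis by (simp add: cylinders_def)
qed

lemma path_event_decomp:
  assumes "determined n \<phi>"
  shows "path_event \<phi> = (\<Union>x\<in>cylinders n \<phi>. path_event (\<lambda>a. \<forall>k\<in>{1..n}. a k = x k))"
proof (intro equalityI subsetI)
  fix \<omega> assume \<omega>: "\<omega> \<in> path_event \<phi>"
  let ?x = "restrict (\<lambda>k. Y k \<omega>) {1..n}"
  have "\<phi> ?x" using \<omega> by (auto intro: determinedD[OF assms])
  then have "?x \<in> cylinders n \<phi>" using \<omega> step_in_directions by (auto simp: cylinders_def)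
  then show "\<omega> \<in> (\<Union>x\<in>cylinders n \<phi>. path_event (\<lambda>a. \<forall>k\<in>{1..n}. a k = x k))"
    using \<omega> by (intro UN_I[of ?x]) auto
next
  fix \<omega> assume "\<omega> \<in> (\<Union>x\<in>cylinders n \<phi>. path_event (\<lambda>a. \<forall>k\<in>{1..n}. a k = x k))"
  then show "\<omega> \<in> path_event \<phi>"
    by (auto simp: cylinders_def intro: determinedD[OF assms])
qed

lemma path_event_measurable: "determined n \<phi> \<Longrightarrow> path_event \<phi> \<in> events"
  by (simp only: path_event_decomp sets.finite_UN finite_cylinders cylinder_event)

text \<open>The second event \<open>E\<close> is a prescribed next step in one application and the
  whole space in another; comparing the two gives \<open>markov_determined\<close>.\<close>

lemma prob_path_event_decomp:
  assumes "determined n \<phi>" "E \<in> events"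
  shows "prob (path_event \<phi> \<inter> E) =
    (\<Sum>x\<in>cylinders n \<phi>. prob (path_event (\<lambda>a. \<forall>k\<in>{1..n}. a k = x k) \<inter> E))"
proof -
  have "disjoint_family_on (\<lambda>x. path_event (\<lambda>a. \<forall>k\<in>{1..n}. a k = x k) \<inter> E) (cylinders n \<phi>)"
    unfolding disjoint_family_on_def
  proof (intro ballI impI)
    fix x x' assume x: "x \<in> cylinders n \<phi>" "x' \<in> cylinders n \<phi>" "x \<noteq> x'"
    then obtain k where "k \<in> {1..n}" "x k \<noteq> x' k"
      by (metis (no_types, lifting) PiE_ext cylinders_def mem_Collect_eq)
    then show "(path_event (\<lambda>a. \<forall>k\<in>{1..n}. a k = x k) \<inter> E) \<inter>
        (path_event (\<lambda>a. \<forall>k\<in>{1..n}. a k = x' k) \<inter> E) = {}"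
      by force
  qed
  then have "prob (\<Union>x\<in>cylinders n \<phi>. path_event (\<lambda>a. \<forall>k\<in>{1..n}. a k = x k) \<inter> E) =
      (\<Sum>x\<in>cylinders n \<phi>. prob (path_event (\<lambda>a. \<forall>k\<in>{1..n}. a k = x k) \<inter> E))"
    using sets.Int[OF cylinder_event assms(2)]
    by (intro finite_measure_finite_Union finite_cylinders) blast
  moreover have "path_event \<phi> \<inter> E = (\<Union>x\<in>cylinders n \<phi>. path_event (\<lambda>a. \<forall>k\<in>{1..n}. a k = x k) \<inter> E)"
    unfolding path_event_decomp[OF assms(1)] by blast
  ultimately show ?thesis by simp
qed

text \<open>Sum the Markov property over the histories in the event. Those of probability zero
  contribute nothing to either side; on the others the transition probability is the same, since the
  last step is always \<open>y\<close>.\<close>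

lemma markov_determined:
  assumes det: "determined n \<phi>" and n: "1 \<le> n" and z: "z \<in> directions"
    and y: "\<And>a. \<phi> a \<Longrightarrow> a n = y"
  shows "prob (path_event (\<lambda>a. \<phi> a \<and> a (Suc n) = z)) =
    prob (path_event \<phi>) * step_matrix (update_prob (\<lambda>_. q) n) y z"
proof -
  let ?E = "{\<omega> \<in> space M. Y (Suc n) \<omega> = z}" and ?T = "step_matrix (update_prob (\<lambda>_. q) n) y z"
  let ?C = "\<lambda>x. path_event (\<lambda>a. \<forall>k\<in>{1..n}. a k = x k)"
  have *: "prob (?C x \<inter> ?E) = prob (?C x) * ?T" if x: "x \<in> cylinders n \<phi>" for x
  proof (cases "prob (?C x) = 0")
    case True
    have "prob (?C x \<inter> ?E) \<le> prob (?C x)"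
      by (intro finite_measure_mono cylinder_event) auto
    then have "prob (?C x \<inter> ?E) = 0" using True measure_nonneg[of M "?C x \<inter> ?E"] by linarith
    then show ?thesis using True by simp
  next
    case False
    then have pos: "prob (?C x) > 0" using measure_nonneg[of M "?C x"] by linarith
    have dir: "\<forall>k\<in>{1..n}. x k \<in> directions" and "x n = y"
      using x y by (auto simp: cylinders_def)
    then have "cond_prob M (\<lambda>\<omega>. Y (Suc n) \<omega> = z) (\<lambda>\<omega>. \<forall>k\<in>{1..n}. Y k \<omega> = x k) = ?T"
      using markov[OF n dir z pos] by simp
    moreover have "?C x \<inter> ?E = {\<omega> \<in> space M. Y (Suc n) \<omega> = z \<and> (\<forall>k\<in>{1..n}. Y k \<omega> = x k)}"
      by auto
    ultimately show ?thesis using pos by (simp add: cond_prob_def field_simps)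
  qed
  have "path_event (\<lambda>a. \<phi> a \<and> a (Suc n) = z) = path_event \<phi> \<inter> ?E" by auto
  then have "prob (path_event (\<lambda>a. \<phi> a \<and> a (Suc n) = z)) = (\<Sum>x\<in>cylinders n \<phi>. prob (?C x \<inter> ?E))"
    using prob_path_event_decomp[OF det step_event[of "Suc n" z]] by simp
  also have "\<dots> = (\<Sum>x\<in>cylinders n \<phi>. prob (?C x)) * ?T"
    using * by (simp add: sum_distrib_right)
  also have "(\<Sum>x\<in>cylinders n \<phi>. prob (?C x)) = prob (path_event \<phi>)"
  proof -
    have "{\<omega> \<in> space M. P \<omega>} \<inter> space M = {\<omega> \<in> space M. P \<omega>}" for P by auto
    then show ?thesis using prob_path_event_decomp[OF det sets.top] by (simp only:)
  qed
  finally show ?thesis .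
qed

lemma prob_split_step:
  assumes "path_event \<phi> \<in> events" "1 \<le> k"
  shows "prob (path_event \<phi>) = (\<Sum>z\<in>directions. prob (path_event (\<lambda>a. a k = z \<and> \<phi> a)))"
proof -
  have eq: "path_event (\<lambda>a. a k = z \<and> \<phi> a) = {\<omega> \<in> space M. Y k \<omega> = z} \<inter> path_event \<phi>" for z
    by auto
  have "path_event \<phi> = (\<Union>z\<in>directions. path_event (\<lambda>a. a k = z \<and> \<phi> a))"
    using step_in_directions[OF assms(2)] by auto
  moreover have "path_event (\<lambda>a. a k = z \<and> \<phi> a) \<in> events" for z
    unfolding eq using step_event[OF assms(2)] assms(1) by auto
  then have "prob (\<Union>z\<in>directions. path_event (\<lambda>a. a k = z \<and> \<phi> a)) =
      (\<Sum>z\<in>directions. prob (path_event (\<lambda>a. a k = z \<and> \<phi> a)))"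
    by (intro finite_measure_finite_Union) (auto simp: disjoint_family_on_def)
  ultimately show ?thesis by simp
qed

text \<open>\<open>\<phi>\<close> fixes the state of the chain (position, last step) at time
  \<open>n\<close>, and the claim follows by induction on the next step. Starting at
  \<open>2 \<le> n\<close> makes every transition use \<open>q\<close> rather than the conventional
  1. Taking \<open>Z = {}\<close> gives hitting probabilities, \<open>Z = {0}\<close> avoidance
  probabilities.\<close>

lemma prob_future:
  assumes "determined n \<phi>" "2 \<le> n" "\<And>a. \<phi> a \<Longrightarrow> endpoint n a = x \<and> a n = y"
  shows "prob (path_event (\<lambda>a. \<phi> a \<and> (\<forall>m\<in>{n<..n + N}. endpoint m a \<notin> Z) \<and> h (endpoint (n + N) a))) =
    prob (path_event \<phi>) * (step_op q Z ^^ N) (\<lambda>x _. of_bool (h x)) x y"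
  using assms
proof (induction N arbitrary: n \<phi> x y)
  case 0
  have "path_event (\<lambda>a. \<phi> a \<and> h (endpoint n a)) = (if h x then path_event \<phi> else {})"
    using "0.prems"(3) by auto
  then show ?case by auto
next
  case (Suc N)
  let ?F = "\<lambda>n N a. (\<forall>m\<in>{n<..n + N}. endpoint m a \<notin> Z) \<and> h (endpoint (n + N) a)"
  \<comment> \<open>The past extended by one step. On \<open>\<phi>\<close> the next position is
    \<open>x + z\<close>, so the first avoidance condition becomes one that is independent of the
    path.\<close>
  let ?\<phi> = "\<lambda>z a. (\<phi> a \<and> a (Suc n) = z) \<and> x + z \<notin> Z"
  have ins: "{n<..n + Suc N} = insert (Suc n) {Suc n<..Suc n + N}" by auto
  have eq: "path_event (\<lambda>a. a (Suc n) = z \<and> \<phi> a \<and> ?F n (Suc N) a) =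
      path_event (\<lambda>a. ?\<phi> z a \<and> ?F (Suc n) N a)" for z
    unfolding ins using Suc.prems(3) by auto
  have "determined (n + Suc N) (\<lambda>a. \<phi> a \<and> ?F n (Suc N) a)"
    by (intro determined_conj determined_Ball determined_endpoint determined_mono[OF Suc.prems(1)]) auto
  then have "prob (path_event (\<lambda>a. \<phi> a \<and> ?F n (Suc N) a)) =
      (\<Sum>z\<in>directions. prob (path_event (\<lambda>a. a (Suc n) = z \<and> \<phi> a \<and> ?F n (Suc N) a)))"
    by (intro prob_split_step path_event_measurable) auto
  also have "\<dots> = (\<Sum>z\<in>directions. prob (path_event (\<lambda>a. ?\<phi> z a \<and> ?F (Suc n) N a)))"
    unfolding eq ..
  also have "\<dots> = (\<Sum>z\<in>directions. prob (path_event (?\<phi> z)) *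
      (step_op q Z ^^ N) (\<lambda>x _. of_bool (h x)) (x + z) z)"
  proof (rule sum.cong)
    fix z
    have "determined (Suc n) (?\<phi> z)"
      by (intro determined_conj determined_mono[OF Suc.prems(1)] determined_step[where P = "\<lambda>c. c = z"])
        (auto simp: determined_def)
    then show "prob (path_event (\<lambda>a. ?\<phi> z a \<and> ?F (Suc n) N a)) =
        prob (path_event (?\<phi> z)) * (step_op q Z ^^ N) (\<lambda>x _. of_bool (h x)) (x + z) z"
      by (rule Suc.IH) (use Suc.prems in auto)
  qed simp
  also have "\<dots> = (\<Sum>z\<in>directions. prob (path_event \<phi>) * (step_matrix q y z *
      (of_bool (x + z \<notin> Z) * (step_op q Z ^^ N) (\<lambda>x _. of_bool (h x)) (x + z) z)))"
  proof (rule sum.cong)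
    fix z :: "int ^ 'd" assume "z \<in> directions"
    then have "prob (path_event (\<lambda>a. \<phi> a \<and> a (Suc n) = z)) = prob (path_event \<phi>) * step_matrix q y z"
      using markov_determined[OF Suc.prems(1), of z y] Suc.prems(2,3) by (auto simp: update_prob_def)
    then have "prob (path_event (?\<phi> z)) = prob (path_event \<phi>) * step_matrix q y z * of_bool (x + z \<notin> Z)"
      by auto
    then show "prob (path_event (?\<phi> z)) * (step_op q Z ^^ N) (\<lambda>x _. of_bool (h x)) (x + z) z =
        prob (path_event \<phi>) * (step_matrix q y z *
          (of_bool (x + z \<notin> Z) * (step_op q Z ^^ N) (\<lambda>x _. of_bool (h x)) (x + z) z))"
      by (simp only: mult.assoc)
  qed simp
  also have "\<dots> = prob (path_event \<phi>) * (step_op q Z ^^ Suc N) (\<lambda>x _. of_bool (h x)) x y"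
    by (simp add: step_op_def sum_distrib_left)
  finally show ?case .
qed

text \<open>At time 1 \<open>update_prob\<close> is 1, so the identity part of the transition matrix
  vanishes and the second step is uniform whether or not \<open>y = z\<close>.\<close>

lemma prob_first_two_steps:
  assumes y: "y \<in> directions" and z: "z \<in> directions"
  shows "prob (path_event (\<lambda>a. a 1 = y \<and> a 2 = z)) = (1 / (2 * real CARD('d)))\<^sup>2"
proof -
  have "prob (path_event (\<lambda>a. a 1 = y)) = measure (distr M (count_space directions) (Y 1)) {y}"
    using y by (subst measure_distr[OF step_measurable]) (auto intro!: arg_cong[where f = prob])
  also have "\<dots> = 1 / (2 * real CARD('d))"
    unfolding first_step_uniform
    using y by (subst measure_uniform_count_measure) (simp_all add: card_directions)
  finally have "prob (path_event (\<lambda>a. a 1 = y)) = 1 / (2 * real CARD('d))" .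
  moreover have "determined 1 (\<lambda>a :: nat \<Rightarrow> int ^ 'd. a 1 = y)"
    by (simp add: determined_def)
  ultimately show ?thesis
    using markov_determined[of 1 "\<lambda>a. a 1 = y" z y] z
    by (simp add: update_prob_def step_matrix_def power2_eq_square numeral_2_eq_2)
qed

lemma endpoint_2: "endpoint 2 a = a 1 + a 2"
  by (simp add: numeral_2_eq_2 endpoint_def)

text \<open>Since \<open>p\<^sub>1 = 1\<close>, the second step is uniform instead of following \<^term>\<open>step_matrix q\<close>,
  which costs a constant factor compared with the stationary walk.\<close>

lemma return_probability_ge:
  "prob (path_event (\<lambda>a. endpoint (2 + N) a = 0)) \<ge> occ (2 + N) (0 :: int ^ 'd) / (2 * real CARD('d))"
proof -
  let ?c = "1 / (2 * real CARD('d))"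
  let ?R = "\<lambda>a :: nat \<Rightarrow> int ^ 'd. endpoint (2 + N) a = 0"
  have det: "determined (2 + N) ?R" by (rule determined_endpoint) simp
  have *: "prob (path_event (\<lambda>a. a 2 = z \<and> a 1 = y \<and> ?R a)) = ?c\<^sup>2 * hit N 0 (y + z) z"
    if y: "y \<in> directions" and z: "z \<in> directions" for y z
  proof -
    have "determined 2 (\<lambda>a. a 1 = y \<and> a 2 = z)"
      by (simp add: determined_def)
    then have "prob (path_event (\<lambda>a. (a 1 = y \<and> a 2 = z) \<and> (\<forall>m\<in>{2<..2 + N}. endpoint m a \<notin> {}) \<and> ?R a)) =
        prob (path_event (\<lambda>a. a 1 = y \<and> a 2 = z)) * (step_op q {} ^^ N) (\<lambda>x _. of_bool (x = 0)) (y + z) z"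
      by (rule prob_future) (auto simp: endpoint_2)
    moreover have "path_event (\<lambda>a. (a 1 = y \<and> a 2 = z) \<and> (\<forall>m\<in>{2<..2 + N}. endpoint m a \<notin> {}) \<and> ?R a) =
        path_event (\<lambda>a. a 2 = z \<and> a 1 = y \<and> ?R a)"
      by auto
    ultimately show ?thesis
      using prob_first_two_steps[OF y z] by (simp only: hit_def)
  qed
  have "prob (path_event ?R) = (\<Sum>y\<in>directions. prob (path_event (\<lambda>a. a 1 = y \<and> ?R a)))"
    by (intro prob_split_step path_event_measurable[OF det]) simp
  also have "\<dots> = (\<Sum>y\<in>directions. \<Sum>z\<in>directions. prob (path_event (\<lambda>a. a 2 = z \<and> a 1 = y \<and> ?R a)))"
  proof (rule sum.cong)
    fix y
    have "determined (2 + N) (\<lambda>a. a 1 = y \<and> ?R a)"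
      by (intro determined_conj det determined_step[where P = "\<lambda>c. c = y"]) auto
    then show "prob (path_event (\<lambda>a. a 1 = y \<and> ?R a)) =
        (\<Sum>z\<in>directions. prob (path_event (\<lambda>a. a 2 = z \<and> a 1 = y \<and> ?R a)))"
      by (intro prob_split_step path_event_measurable) auto
  qed simp
  also have "\<dots> = (\<Sum>y\<in>directions. \<Sum>z\<in>directions. ?c\<^sup>2 * hit N (0 :: int ^ 'd) (y + z) z)"
    by (intro sum.cong refl *)
  \<comment> \<open>Inserting the factor \<open>step_matrix q y z \<le> 1\<close> replaces the
    uniform second step by a transition of the stationary walk.\<close>
  also have "\<dots> \<ge> (\<Sum>y\<in>directions. \<Sum>z\<in>directions. ?c\<^sup>2 * (step_matrix q y z * hit N (0 :: int ^ 'd) (y + z) z))"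
    by (intro sum_mono mult_left_mono mult_left_le_one_le)
      (auto simp: hit_nonneg step_matrix_nonneg step_matrix_le_1)
  also have "(\<Sum>y\<in>directions. \<Sum>z\<in>directions. ?c\<^sup>2 * (step_matrix q y z * hit N (0 :: int ^ 'd) (y + z) z)) =
      ?c * occ (2 + N) (0 :: int ^ 'd)"
    \<comment> \<open>Here \<open>y\<close> is the first step and \<open>z\<close> the second;
      \<open>occ\<close> accounts for one of the two factors \<open>?c\<close>.\<close>
    unfolding add_2_eq_Suc occ_Suc hit_Suc
    by (simp add: power2_eq_square sum_distrib_left sum_divide_distrib)
  finally show ?thesis by simp
qed

section \<open>Recurrence\<close>

text \<open>Probability of no visit to 0 during the next \<open>N\<close> steps. The starting point
  itself is not tested, so \<open>x = 0\<close> is a meaningful start.\<close>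

definition avoid :: "nat \<Rightarrow> int ^ 'd \<Rightarrow> int ^ 'd \<Rightarrow> real"
  where "avoid N = (step_op q {0} ^^ N) (\<lambda>_ _. 1)"

lemma avoid_nonneg: "y \<in> directions \<Longrightarrow> 0 \<le> avoid N x y"
  unfolding avoid_def by (rule funpow_step_op_nonneg) auto

lemma avoid_Suc:
  "avoid (Suc N) x y = (\<Sum>z\<in>directions. step_matrix q y z * (of_bool (x + z \<noteq> 0) * avoid N (x + z) z))"
  by (simp add: avoid_def step_op_def)

lemma avoid_decreasing:
  assumes "y \<in> directions" "K \<le> N"
  shows "avoid N x y \<le> avoid K x y"
proof -
  have "avoid (Suc n) x y \<le> avoid n x y" for n
    \<comment> \<open>The innermost application is the last step; it maps 1 to at most 1, and the
      outer steps are monotone.\<close>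
    unfolding avoid_def funpow_Suc_right comp_def
  proof (rule funpow_step_op_mono[OF _ assms(1)])
    fix x z :: "int ^ 'd" assume z: "z \<in> directions"
    have "step_op q {0} (\<lambda>_ _. 1) x z \<le> (\<Sum>w\<in>directions. step_matrix q z w)"
      unfolding step_op_def by (intro sum_mono) (auto simp: step_matrix_nonneg)
    then show "step_op q {0} (\<lambda>_ _. 1) x z \<le> 1"
      using sum_step_matrix_1[OF z] by simp
  qed
  then show ?thesis using lift_Suc_antimono_le[of "\<lambda>n. avoid n x y" K N] assms(2) by auto
qed

lemma prob_avoid:
  assumes "determined n \<phi>" "2 \<le> n" "\<And>a. \<phi> a \<Longrightarrow> endpoint n a = x \<and> a n = y"
  shows "prob (path_event (\<lambda>a. \<phi> a \<and> (\<forall>m\<in>{n<..n + N}. endpoint m a \<noteq> 0))) =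
    prob (path_event \<phi>) * avoid N x y"
  using prob_future[OF assms, of N "{0}" "\<lambda>_. True"] by (simp add: avoid_def)

text \<open>At most one of the first \<open>N\<close> visits is followed by \<open>N\<close> steps without a visit.\<close>

lemma last_exit:
  "(\<Sum>n<N. prob (path_event (\<lambda>a. endpoint (2 + n) a = 0 \<and> a (2 + n) = y))) * avoid N 0 y \<le> 1"
proof -
  let ?\<phi> = "\<lambda>n (a :: nat \<Rightarrow> int ^ 'd). endpoint (2 + n) a = 0 \<and> a (2 + n) = y"
  let ?E = "\<lambda>n. path_event (\<lambda>a. ?\<phi> n a \<and> (\<forall>m\<in>{2 + n<..2 + n + N}. endpoint m a \<noteq> 0))"
  have det: "determined k (?\<phi> n)" if "2 + n \<le> k" for n k
    using that by (intro determined_conj determined_endpoint determined_step[where P = "\<lambda>c. c = y"]) auto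
  have ev: "?E n \<in> events" for n
  proof (rule path_event_measurable)
    show "determined (2 + n + N) (\<lambda>a. ?\<phi> n a \<and> (\<forall>m\<in>{2 + n<..2 + n + N}. endpoint m a \<noteq> 0))"
      by (intro determined_conj[OF det] determined_Ball determined_endpoint[where P = "\<lambda>c. c \<noteq> 0"]) auto
  qed
  have disj: "?E n \<inter> ?E k = {}" if "n < k" "k < N" for n k
  proof -
    \<comment> \<open>Because \<open>k < N\<close>, the later visit falls into the window that the
      earlier event keeps free of visits.\<close>
    have "2 + k \<in> {2 + n<..2 + n + N}" using that by auto
    then show ?thesis by blast
  qed
  have "(\<Sum>n<N. prob (path_event (?\<phi> n))) * avoid N 0 y = (\<Sum>n<N. prob (?E n))"
    unfolding sum_distrib_right
  proof (rule sum.cong)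
    fix n
    show "prob (path_event (?\<phi> n)) * avoid N 0 y = prob (?E n)"
      by (rule prob_avoid[symmetric, OF det]) auto
  qed simp
  also have "\<dots> = prob (\<Union>n<N. ?E n)"
  proof (rule finite_measure_finite_Union[symmetric])
    show "disjoint_family_on ?E {..<N}"
      unfolding disjoint_family_on_def
    proof (intro ballI impI)
      fix n k assume "n \<in> {..<N}" "k \<in> {..<N}" "n \<noteq> k"
      then show "?E n \<inter> ?E k = {}"
      proof (cases "n < k")
        case True
        then show ?thesis using \<open>k \<in> {..<N}\<close> by (intro disj) auto
      next
        case False
        then have "?E k \<inter> ?E n = {}"
          using \<open>n \<in> {..<N}\<close> \<open>n \<noteq> k\<close> by (intro disj) auto
        then show ?thesis by (subst Int_commute)
      qed
    qed
  qed (use ev in auto)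
  also have "\<dots> \<le> 1" by simp
  finally show ?thesis .
qed

text \<open>Otherwise monotonicity keeps \<open>avoid N 0 y\<close> above some \<open>e > 0\<close>,
  and \<open>last_exit\<close> bounds the expected number of visits by \<open>1 / e\<close>.\<close>

lemma avoid_tendsto_0_if_not_summable:
  assumes y: "y \<in> directions"
    and ns: "\<not> summable (\<lambda>n. prob (path_event (\<lambda>a. endpoint (2 + n) a = 0 \<and> a (2 + n) = y)))"
  shows "(\<lambda>N. avoid N 0 y) \<longlonglongrightarrow> 0"
proof (rule ccontr)
  assume "\<not> (\<lambda>N. avoid N 0 y) \<longlonglongrightarrow> 0"
  then obtain e where e: "e > 0" "\<And>K. \<exists>N\<ge>K. avoid N 0 y \<ge> e"
    using avoid_nonneg[OF y, of _ 0] unfolding lim_sequentially by (fastforce simp: not_less)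
  have ge: "avoid N 0 y \<ge> e" for N
    using e(2)[of N] avoid_decreasing[OF y] by (meson order_trans)
  have "summable (\<lambda>n. prob (path_event (\<lambda>a. endpoint (2 + n) a = 0 \<and> a (2 + n) = y)))"
  proof (rule summableI_nonneg_bounded)
    fix N
    let ?s = "\<Sum>n<N. prob (path_event (\<lambda>a. endpoint (2 + n) a = 0 \<and> a (2 + n) = y))"
    have "?s * e \<le> ?s * avoid N 0 y" by (intro mult_left_mono ge sum_nonneg) auto
    then have "?s * e \<le> 1" using last_exit[where N = N and y = y] by linarith
    then show "?s \<le> 1 / e" using e(1) by (simp add: field_simps)
  qed simp
  then show False using ns by contradiction
qed

text \<open>Each direction has positive probability, so \<open>avoid (Suc N) x y\<close> is at least
  a fixed positive multiple of \<open>avoid N (x + z) z\<close>.\<close>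

lemma avoid_tendsto_0_step:
  assumes lim: "(\<lambda>N. avoid N x y) \<longlonglongrightarrow> 0" and z: "z \<in> directions" "x + z \<noteq> 0"
  shows "(\<lambda>N. avoid N (x + z) z) \<longlonglongrightarrow> 0"
proof (rule tendsto_sandwich[OF _ _ tendsto_const])
  have "(\<lambda>N. avoid (Suc N) x y / step_matrix q y z) \<longlonglongrightarrow> 0 / step_matrix q y z"
    using lim step_matrix_pos[of y z] by (intro tendsto_divide tendsto_const LIMSEQ_Suc) auto
  then show "(\<lambda>N. avoid (Suc N) x y / step_matrix q y z) \<longlonglongrightarrow> 0" by simp
  have "step_matrix q y z * avoid N (x + z) z \<le> avoid (Suc N) x y" for N
  proof -
    have "step_matrix q y z * (of_bool (x + z \<noteq> 0) * avoid N (x + z) z) \<le> avoid (Suc N) x y"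
      unfolding avoid_Suc using z(1)
      by (intro member_le_sum[where f = "\<lambda>z. step_matrix q y z * (of_bool (x + z \<noteq> 0) * avoid N (x + z) z)"])
        (auto simp: step_matrix_nonneg avoid_nonneg)
    then show ?thesis using z(2) by simp
  qed
  then show "\<forall>\<^sub>F N in sequentially. avoid N (x + z) z \<le> avoid (Suc N) x y / step_matrix q y z"
    using step_matrix_pos[of y z] by (simp add: field_simps)
qed (simp add: avoid_nonneg z(1))

text \<open>First-step analysis: a finite sum of null sequences, in which steps that land on 0
  contribute nothing.\<close>

lemma avoid_tendsto_0_back:
  assumes "\<And>z. z \<in> directions \<Longrightarrow> x + z \<noteq> 0 \<Longrightarrow> (\<lambda>N. avoid N (x + z) z) \<longlonglongrightarrow> 0"
  shows "(\<lambda>N. avoid N x y) \<longlonglongrightarrow> 0"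
proof (rule LIMSEQ_imp_Suc)
  have "(\<lambda>N. step_matrix q y z * (of_bool (x + z \<noteq> 0) * avoid N (x + z) z)) \<longlonglongrightarrow> 0"
    if "z \<in> directions" for z
    using assms[OF that] by (cases "x + z = 0") (auto intro: tendsto_mult_right_zero)
  then show "(\<lambda>N. avoid (Suc N) x y) \<longlonglongrightarrow> 0"
    unfolding avoid_Suc by (rule tendsto_null_sum)
qed

text \<open>Never returning is contained in each of the events of avoiding 0 for \<open>N\<close>
  steps, whose probabilities tend to zero.\<close>

lemma AE_return:
  assumes det: "determined n \<phi>" and n: "2 \<le> n" and x: "\<And>a. \<phi> a \<Longrightarrow> endpoint n a = x \<and> a n = y"
    and lim: "(\<lambda>N. avoid N x y) \<longlonglongrightarrow> 0"
  shows "AE \<omega> in M. \<phi> (\<lambda>k. Y k \<omega>) \<longrightarrow> (\<exists>m>n. position Y m \<omega> = 0)"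
proof -
  let ?E = "\<lambda>N. path_event (\<lambda>a. \<phi> a \<and> (\<forall>m\<in>{n<..n + N}. endpoint m a \<noteq> 0))"
  have meas: "?E N \<in> events" for N
  proof (rule path_event_measurable)
    show "determined (n + N) (\<lambda>a. \<phi> a \<and> (\<forall>m\<in>{n<..n + N}. endpoint m a \<noteq> 0))"
      by (intro determined_conj determined_mono[OF det] determined_Ball
          determined_endpoint[where P = "\<lambda>c. c \<noteq> 0"]) auto
  qed
  then have ev: "(\<Inter>N. ?E N) \<in> events" by (intro sets.countable_INT) auto
  have "prob (\<Inter>N. ?E N) \<le> prob (path_event \<phi>) * avoid N x y" for N
  proof -
    have "prob (\<Inter>N. ?E N) \<le> prob (?E N)"
      using meas by (intro finite_measure_mono INF_lower) auto
    then show ?thesis using prob_avoid[OF det n x] by simp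
  qed
  then have "prob (\<Inter>N. ?E N) \<le> 0"
    using lim by (intro LIMSEQ_le_const[OF tendsto_mult_right_zero]) auto
  then have "AE \<omega> in M. \<omega> \<notin> (\<Inter>N. ?E N)"
    using prob_eq_0[OF ev] measure_nonneg[of M "\<Inter>N. ?E N"] by linarith
  then show ?thesis
  proof (rule AE_mp, intro AE_I2 impI)
    fix \<omega> assume "\<omega> \<in> space M" "\<omega> \<notin> (\<Inter>N. ?E N)" "\<phi> (\<lambda>k. Y k \<omega>)"
    then show "\<exists>m>n. position Y m \<omega> = 0"
      by (force simp: endpoint_def position_def)
  qed
qed

lemma recurrent_if_not_summable:
  assumes ns: "\<not> summable (\<lambda>n. prob (path_event (\<lambda>a. endpoint (2 + n) a = 0)))"
  shows "recurrent M (position Y)"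
proof -
  let ?\<phi> = "\<lambda>n y (a :: nat \<Rightarrow> int ^ 'd). endpoint (2 + n) a = 0 \<and> a (2 + n) = y"
  have split: "prob (path_event (\<lambda>a. endpoint (2 + n) a = 0)) = (\<Sum>y\<in>directions. prob (path_event (?\<phi> n y)))" for n
  proof -
    have "determined (2 + n) (\<lambda>a :: nat \<Rightarrow> int ^ 'd. endpoint (2 + n) a = 0)"
      by (rule determined_endpoint) simp
    then have "prob (path_event (\<lambda>a. endpoint (2 + n) a = 0)) =
        (\<Sum>y\<in>directions. prob (path_event (\<lambda>a. a (2 + n) = y \<and> endpoint (2 + n) a = 0)))"
      by (intro prob_split_step path_event_measurable) auto
    then show ?thesis by (simp only: conj_commute)
  qed
  \<comment> \<open>Pigeonhole: finitely many summable series would have a summable sum.\<close>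
  have "\<exists>y\<in>directions. \<not> summable (\<lambda>n. prob (path_event (?\<phi> n y)))"
    using ns unfolding split by (rule contrapos_np) (auto intro: summable_sum)
  then obtain y0 where "(\<lambda>N. avoid N 0 y0) \<longlonglongrightarrow> 0"
    using avoid_tendsto_0_if_not_summable by blast
  \<comment> \<open>A step from 0 never lands on 0, so certain return propagates from
    \<open>(0, y0)\<close> to every \<open>(z, z)\<close>. Going back gives all
    \<open>(0, z)\<close>, and going forward again gives every state at time 2.\<close>
  then have diag: "(\<lambda>N. avoid N z z) \<longlonglongrightarrow> 0" if "z \<in> directions" for z
    using avoid_tendsto_0_step[of 0 y0 z] that zero_notin_directions by auto
  have zero: "(\<lambda>N. avoid N 0 z) \<longlonglongrightarrow> 0" for z
    by (rule avoid_tendsto_0_back) (simp add: diag)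
  have two: "(\<lambda>N. avoid N (y + z) z) \<longlonglongrightarrow> 0" if "y \<in> directions" "z \<in> directions" for y z
    using avoid_tendsto_0_step[OF diag] zero that by (cases "y + z = 0") auto
  have "AE \<omega> in M. \<forall>n. \<forall>y\<in>directions. ?\<phi> n y (\<lambda>k. Y k \<omega>) \<longrightarrow> (\<exists>m>2 + n. position Y m \<omega> = 0)"
    unfolding AE_all_countable
  proof (intro allI AE_finite_allI finite_directions)
    fix n and y :: "int ^ 'd"
    have "determined (2 + n) (?\<phi> n y)"
      by (intro determined_conj determined_endpoint determined_step[where P = "\<lambda>c. c = y"]) auto
    then show "AE \<omega> in M. ?\<phi> n y (\<lambda>k. Y k \<omega>) \<longrightarrow> (\<exists>m>2 + n. position Y m \<omega> = 0)"
      by (rule AE_return[where x = 0 and y = y]) (auto simp: zero)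
  qed
  \<comment> \<open>The previous fact yields a further visit after each visit from time 2 on; this
    one supplies a first such visit.\<close>
  moreover have "AE \<omega> in M. \<forall>y\<in>directions. \<forall>z\<in>directions.
      Y 1 \<omega> = y \<and> Y 2 \<omega> = z \<longrightarrow> (\<exists>m>2. position Y m \<omega> = 0)"
  proof (intro AE_finite_allI finite_directions)
    fix y z :: "int ^ 'd" assume yz: "y \<in> directions" "z \<in> directions"
    have "determined 2 (\<lambda>a. a 1 = y \<and> a 2 = z)" by (simp add: determined_def)
    then show "AE \<omega> in M. Y 1 \<omega> = y \<and> Y 2 \<omega> = z \<longrightarrow> (\<exists>m>2. position Y m \<omega> = 0)"
      by (rule AE_return[where x = "y + z" and y = z]) (use two yz in \<open>auto simp: endpoint_2\<close>)
  qed
  ultimately have "AE \<omega> in M. infinite {n. position Y n \<omega> = 0}"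
    using AE_space
  proof eventually_elim
    case (elim \<omega>)
    then obtain m where m: "m > 2" "position Y m \<omega> = 0"
      using step_in_directions[of 1 \<omega>] step_in_directions[of 2 \<omega>] by auto
    show ?case
    proof
      assume fin: "finite {n. position Y n \<omega> = 0}"
      define k where "k = Max {n. position Y n \<omega> = 0}"
      have "k \<ge> m" unfolding k_def using fin m(2) by (intro Max_ge) auto
      \<comment> \<open>The last visit is no earlier than \<open>m > 2\<close>, so the almost sure
        statement about later visits applies to it.\<close>
      then obtain n where n: "k = 2 + n" using m(1) by (metis le_add_diff_inverse less_imp_le order_trans)
      have "position Y k \<omega> = 0" using Max_in[OF fin] m(2) unfolding k_def by blast
      then have "endpoint (2 + n) (\<lambda>k. Y k \<omega>) = 0" by (simp add: n endpoint_def position_def)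
      then obtain m' where "m' > k" "position Y m' \<omega> = 0"
        using elim step_in_directions[of k \<omega>] n by auto
      then show False using Max_ge[OF fin, of m'] by (simp add: k_def)
    qed
  qed
  then show ?thesis by (simp add: recurrent_def)
qed

end

section \<open>Divergence of the expected number of returns in the plane\<close>

theorem theorem2p1:
  fixes M :: "'a measure" and Y :: "nat \<Rightarrow> 'a \<Rightarrow> int ^ 2" and p :: real
  assumes "0 < p" and "p < 1"
    and "conservative_walk M (\<lambda>_. p) Y"
  shows "recurrent M (position Y)"
proof -
  interpret conservative_walk M "\<lambda>_. p" Y by fact
  interpret constant_walk M p Y by unfold_locales (use assms in auto)
  let ?r = "\<lambda>n. prob (path_event (\<lambda>a. endpoint (2 + n) a = 0))"
  have "\<not> summable ?r"
  proof
    assume "summable ?r"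
    \<comment> \<open>Only even times matter, and \<open>2 + 2 * m = 2 * Suc m\<close> is the time
      in \<open>occ_lower_bound\<close>.\<close>
    then have "summable (\<lambda>m. ?r (2 * m))"
      using summable_reindex[of ?r "\<lambda>m. 2 * m"] by (simp add: comp_def inj_on_def)
    \<comment> \<open>\<open>576 = 144 * 4\<close>, where 4 is the number of directions lost in
      \<open>return_probability_ge\<close>.\<close>
    then have "summable (\<lambda>m. inverse (real (Suc m)) * (p ^ 3 / 576))"
    proof (rule summable_comparison_test'[where N = 0])
      fix m
      have "p ^ 3 / 144 / real (Suc m) \<le> occ (2 * Suc m) (0 :: int ^ 2)"
        by (rule occ_lower_bound) simp
      also have "\<dots> \<le> 4 * ?r (2 * m)"
        using return_probability_ge[of "2 * m"] by (simp del: endpoint_Suc)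
      finally have "p ^ 3 / 144 / real (Suc m) / 4 \<le> ?r (2 * m)"
        by (subst pos_divide_le_eq) (simp_all only: mult.commute zero_less_numeral)
      moreover have "norm (inverse (real (Suc m)) * (p ^ 3 / 576)) = p ^ 3 / 144 / real (Suc m) / 4"
        using assms(1) by (simp add: divide_simps)
      ultimately show "norm (inverse (real (Suc m)) * (p ^ 3 / 576)) \<le> ?r (2 * m)"
        by linarith
    qed
    then have "summable (\<lambda>m. inverse (real (Suc m)) * (p ^ 3 / 576) * (576 / p ^ 3))"
      by (rule summable_mult2)
    then have "summable (\<lambda>m. inverse (real (Suc m)))"
      using assms(1) by simp
    then show False
      using not_summable_harmonic[where 'a = real] summable_Suc_iff[of "\<lambda>m. inverse (real m)"] by simp
  qed
  then show ?thesis by (rule recurrent_if_not_summable)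
qed

end
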